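(* Let $b(n)$ be a variable-$r$ meta-Fibonacci sequence generated by $r(n)$. For all $n\ge 1$, $$\min\{\lambda(n),\ \mu(n,r(n)-1)\}\ \le\ \frac{b(n)}{b(n-1)}\ \le\ \max\{\lambda(n),\ \mu(n,r(n-1))\}.$$
   Context: Let $\mathbb{N}$ be the non-negative integers and $\mathbb{Z}^+$ the positive integers. Let $r:\mathbb{N}\to\mathbb{Z}^+$ satisfy $r(0)=1$ and $r(n)\le n$ for all $n\ge 1$. The variable-$r$ meta-Fibonacci sequence generated by $r(n)$ is the sequence $b:\mathbb{N}\to\mathbb{Z}^+$ defined by $b(0)=1$ and $b(n)=\sum_{k=1}^{r(n)} b(n-k)$ for $n\ge 1$. For $n\ge 1$ define $\lambda(n)=1+\frac{r(n)-1}{r(n-1)}$. For $n\ge 1$ and $0\le s\le n$ define $\mu(n,s)=2+[r(n)-r(n-1)-1]\prod_{k=n-s}^{n-1}\frac{1}{r(k)}$, where an empty product (the case $s=0$) equals $1$. *)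

theory Defs
  imports Complex_Main
begin

definition meta_fib_generator :: "(nat \<Rightarrow> nat) \<Rightarrow> bool" where
  "meta_fib_generator r \<longleftrightarrow> (\<forall>n. 0 < r n) \<and> r 0 = 1 \<and> (\<forall>n\<ge>1. r n \<le> n)"

text \<open>
  Since \<open>r n \<le> n\<close> for a generator, the truncated subtraction \<open>n - k\<close> agrees with the
  subtraction of integers for every \<open>k\<close> in the range of summation.
\<close>

function meta_fib :: "(nat \<Rightarrow> nat) \<Rightarrow> nat \<Rightarrow> nat" where
  "meta_fib r n = (if n = 0 then 1 else (\<Sum>k\<in>{1..r n}. meta_fib r (n - k)))"
  by pat_completeness auto
termination
  by (relation "Wellfounded.measure snd") auto

declare meta_fib.simps [simp del]

definition mf_lambda :: "(nat \<Rightarrow> nat) \<Rightarrow> nat \<Rightarrow> real" where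
  "mf_lambda r n = 1 + (real (r n) - 1) / real (r (n - 1))"

definition mf_mu :: "(nat \<Rightarrow> nat) \<Rightarrow> nat \<Rightarrow> nat \<Rightarrow> real" where
  "mf_mu r n s =
     2 + (real (r n) - real (r (n - 1)) - 1) * (\<Prod>k\<in>{n - s..<n}. 1 / real (r k))"

end

theory Submission
  imports Defs
begin

text \<open>
  Write \<open>b = meta_fib r\<close>, \<open>p = r n - 1\<close>, \<open>q = r (n - 1)\<close>, and let \<open>F k\<close> be the sum of the \<open>k\<close> values
  \<open>b (n - 2), b (n - 3), \<dots>\<close>. For \<open>n \<ge> 2\<close> the recursion gives \<open>b (n - 1) = F q\<close> and
  \<open>b n = b (n - 1) + F p\<close>, so that
  \[ \frac{b(n)}{b(n-1)} = 1 + \frac{F(p)}{F(q)} = 2 + \frac{F(p) - F(q)}{b(n-1)}. \]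
  Since \<open>b\<close> is nondecreasing, \<open>F\<close> adds up a nonincreasing sequence, and its averages \<open>F k / k\<close>
  do not increase (\<open>prefix_average_antimono\<close>). Comparing \<open>F p / F q\<close> with \<open>p / q\<close> bounds the first
  form by \<open>\<lambda>\<close>: from below if \<open>p \<le> q\<close>, from above if \<open>q \<le> p\<close>.

  The second form gives the opposite bound. Monotonicity also yields \<open>b k \<le> r k * b (k - 1)\<close>, and
  iterating this shows that a term cannot be too small compared with a later one
  (\<open>meta_fib_growth\<close>). Hence each of the \<open>\<bar>p - q\<bar>\<close> terms in which \<open>F p\<close> and \<open>F q\<close> differ is at least
  \<open>b (n - 1)\<close> times the product in \<open>\<mu>\<close> (\<open>meta_fib_tail_ge\<close>). The smallest of these terms has
  index \<open>n - 1 - max p q\<close>, which is why \<open>s = q\<close> occurs in the upper bound and \<open>s = p\<close> in the lower.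
\<close>

lemma prefix_average_antimono:
  fixes f :: "nat \<Rightarrow> real"
  assumes "antimono f" and "p \<le> q"
  shows "real p * (\<Sum>i<q. f i) \<le> real q * (\<Sum>i<p. f i)"
proof -
  \<comment> \<open>The value \<open>f p\<close> separates the terms before position \<open>p\<close> from those after it.\<close>
  have head: "real p * f p \<le> (\<Sum>i<p. f i)"
    using sum_bounded_below[of "{..<p}" "f p" f] antimonoD[OF assms(1)] by simp
  have tail: "(\<Sum>i\<in>{p..<q}. f i) \<le> real (q - p) * f p"
    using sum_bounded_above[of "{p..<q}" f "f p"] antimonoD[OF assms(1)] by simp
  have split: "(\<Sum>i<q. f i) = (\<Sum>i<p. f i) + (\<Sum>i\<in>{p..<q}. f i)"
    using sum.atLeastLessThan_concat[of 0 p q f] assms(2) by (simp add: lessThan_atLeast0)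
  have "real p * (\<Sum>i\<in>{p..<q}. f i) \<le> real p * (real (q - p) * f p)"
    using tail by (intro mult_left_mono) auto
  also have "\<dots> = real (q - p) * (real p * f p)"
    by simp
  also have "\<dots> \<le> real (q - p) * (\<Sum>i<p. f i)"
    using head by (intro mult_left_mono) auto
  finally show ?thesis
    using assms(2) by (simp add: split algebra_simps)
qed

lemma meta_fib_0 [simp]: "meta_fib r 0 = 1"
  by (simp add: meta_fib.simps)

lemma meta_fib_Suc: "meta_fib r (Suc n) = (\<Sum>i<r (Suc n). meta_fib r (n - i))"
proof -
  have "meta_fib r (Suc n) = (\<Sum>k\<in>{1..r (Suc n)}. meta_fib r (Suc n - k))"
    by (subst meta_fib.simps) simp
  also have "\<dots> = (\<Sum>i<r (Suc n). meta_fib r (n - i))"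
    by (rule sum.reindex_bij_witness[of _ Suc "\<lambda>k. k - 1"]) auto
  finally show ?thesis .
qed

lemma meta_fib_Suc_split:
  assumes "0 < r (Suc (Suc m))"
  shows "meta_fib r (Suc (Suc m)) =
    meta_fib r (Suc m) + (\<Sum>i<r (Suc (Suc m)) - 1. meta_fib r (m - i))"
proof -
  obtain p where "r (Suc (Suc m)) = Suc p"
    using assms gr0_conv_Suc by auto
  then show ?thesis
    using meta_fib_Suc[of r "Suc m"] by (simp add: sum.lessThan_Suc_shift del: sum.lessThan_Suc)
qed

lemma meta_fib_mono:
  assumes "\<And>n. 0 < r n"
  shows "mono (meta_fib r)"
proof (rule mono_iff_le_Suc[THEN iffD2], rule allI)
  fix n
  have "meta_fib r (n - 0) \<le> (\<Sum>i<r (Suc n). meta_fib r (n - i))"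
    using assms by (intro member_le_sum) auto
  then show "meta_fib r n \<le> meta_fib r (Suc n)"
    by (simp add: meta_fib_Suc)
qed

lemma meta_fib_pos:
  assumes "\<And>n. 0 < r n"
  shows "0 < meta_fib r n"
  using monoD[OF meta_fib_mono[where r = r, OF assms], of 0 n] by simp

lemma meta_fib_Suc_le:
  assumes "\<And>n. 0 < r n"
  shows "meta_fib r (Suc n) \<le> r (Suc n) * meta_fib r n"
proof -
  have "(\<Sum>i<r (Suc n). meta_fib r (n - i)) \<le> (\<Sum>i<r (Suc n). meta_fib r n)"
    using monoD[OF meta_fib_mono[OF assms]] by (intro sum_mono) simp
  then show ?thesis
    by (simp add: meta_fib_Suc)
qed

text \<open>Iterating \<open>b k \<le> r k * b (k - 1)\<close> from \<open>k = n\<close> down to \<open>k = n - s + 1\<close>.\<close>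

lemma meta_fib_growth:
  assumes pos: "\<And>n. 0 < r n" and "s \<le> n"
  shows "real (meta_fib r n) * (\<Prod>k\<in>{Suc n - s..<Suc n}. 1 / real (r k)) \<le> real (meta_fib r (n - s))"
  using assms(2)
proof (induction s)
  case 0
  then show ?case by simp
next
  case (Suc s)
  then obtain l where l: "n - s = Suc l" "n - Suc s = l" "Suc n - s = Suc (Suc l)"
    by (cases "n - s") auto
  let ?P = "\<Prod>k\<in>{Suc n - s..<Suc n}. 1 / real (r k)"
  have "{Suc n - Suc s..<Suc n} = insert (Suc l) {Suc n - s..<Suc n}"
    using l Suc.prems by auto
  then have "(\<Prod>k\<in>{Suc n - Suc s..<Suc n}. 1 / real (r k)) = ?P / real (r (Suc l))"
    using l by simp
  moreover have "real (meta_fib r n) * ?P \<le> real (meta_fib r (Suc l))"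
    using Suc l by simp
  moreover have "real (meta_fib r (Suc l)) \<le> real (r (Suc l)) * real (meta_fib r l)"
    using meta_fib_Suc_le[where r = r, OF pos, of l] by (metis of_nat_le_iff of_nat_mult)
  ultimately show ?case
    using l pos[of "Suc l"] by (simp add: divide_le_eq mult.commute)
qed

text \<open>
  All terms are estimated by the last one, \<open>i = q - 1\<close>, which is the smallest; this is why the
  product has exactly \<open>q\<close> factors.
\<close>

lemma meta_fib_tail_ge:
  assumes pos: "\<And>n. 0 < r n" and "p \<le> q" and "q \<le> Suc m"
  shows "(real q - real p) * (\<Prod>k\<in>{Suc (Suc m) - q..<Suc (Suc m)}. 1 / real (r k))
      * real (meta_fib r (Suc m))
    \<le> (\<Sum>i<q. real (meta_fib r (m - i))) - (\<Sum>i<p. real (meta_fib r (m - i)))"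
proof -
  let ?P = "\<Prod>k\<in>{Suc (Suc m) - q..<Suc (Suc m)}. 1 / real (r k)"
  have "real (meta_fib r (Suc m)) * ?P \<le> real (meta_fib r (m - i))" if "i \<in> {p..<q}" for i
  proof -
    have "meta_fib r (Suc m - q) \<le> meta_fib r (m - i)"
      using that by (intro monoD[OF meta_fib_mono[where r = r, OF pos]]) auto
    then show ?thesis
      using meta_fib_growth[where r = r, OF pos assms(3)] by linarith
  qed
  then have "real (q - p) * (real (meta_fib r (Suc m)) * ?P)
      \<le> (\<Sum>i\<in>{p..<q}. real (meta_fib r (m - i)))"
    using sum_bounded_below[of "{p..<q}" "real (meta_fib r (Suc m)) * ?P"] by simp
  moreover have "(\<Sum>i<q. real (meta_fib r (m - i))) =
      (\<Sum>i<p. real (meta_fib r (m - i))) + (\<Sum>i\<in>{p..<q}. real (meta_fib r (m - i)))"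
    using sum.atLeastLessThan_concat[of 0 p q "\<lambda>i. real (meta_fib r (m - i))"] assms(2)
    by (simp add: lessThan_atLeast0)
  ultimately show ?thesis
    using assms(2) by (simp add: mult_ac)
qed

theorem mainTheorem1:
  fixes r :: "nat \<Rightarrow> nat" and n :: nat
  assumes "meta_fib_generator r"
    and "n \<ge> 1"
  shows "min (mf_lambda r n) (mf_mu r n (r n - 1))
           \<le> real (meta_fib r n) / real (meta_fib r (n - 1))
       \<and> real (meta_fib r n) / real (meta_fib r (n - 1))
           \<le> max (mf_lambda r n) (mf_mu r n (r (n - 1)))"
proof -
  have pos: "\<And>k. 0 < r k" and r0: "r 0 = 1" and rle: "\<And>k. k \<ge> 1 \<Longrightarrow> r k \<le> k"
    using assms(1) by (auto simp: meta_fib_generator_def)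
  show ?thesis
  proof (cases "n = 1")
    \<comment> \<open>Here \<open>b (n - 1) = b 0\<close> is the initial value and not a sum; both bounds are equal to 1.\<close>
    case True
    have r1: "r (Suc 0) = 1"
      using rle[of 1] pos[of 1] by simp
    have "meta_fib r (Suc 0) = 1"
      using meta_fib_Suc[of r 0] r1 by simp
    then show ?thesis
      using True r0 r1 by (simp add: mf_lambda_def mf_mu_def)
  next
    case False
    then obtain m where n: "n = Suc (Suc m)"
      using assms(2) that[of "n - 2"] by simp
    define p where "p = r n - 1"
    define q where "q = r (n - 1)"
    define F where "F k = (\<Sum>i<k. real (meta_fib r (m - i)))" for k
    define B where "B = real (meta_fib r (n - 1))"
    define P where "P s = (\<Prod>k\<in>{n - s..<n}. 1 / real (r k))" for s
    have p: "p \<le> Suc m" "real (r n) = real p + 1"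
      using rle[of n] pos[of n] by (auto simp: p_def n)
    have q: "q \<le> Suc m" "0 < q"
      using rle[of "Suc m"] pos by (auto simp: q_def n)
    have "0 < B"
      unfolding B_def of_nat_0_less_iff using pos by (rule meta_fib_pos)
    moreover have "B = F q"
      by (simp add: B_def F_def q_def n meta_fib_Suc)
    ultimately have B: "0 < B" "B = F q"
      by simp_all
    have "real (meta_fib r n) = B + F p"
      using meta_fib_Suc_split[where r = r, OF pos, of m] by (simp add: B_def F_def p_def n)
    then have ratio: "real (meta_fib r n) / B = 1 + F p / B"
      using B by (simp add: field_simps)
    have lam: "mf_lambda r n = 1 + real p / real q"
      using p by (simp add: mf_lambda_def q_def)
    have mu: "mf_mu r n s = 2 + (real p - real q) * P s" for s
      using p by (simp add: mf_mu_def P_def q_def)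
    have anti: "antimono (\<lambda>i. real (meta_fib r (m - i)))"
      using monoD[OF meta_fib_mono[where r = r, OF pos]] by (auto intro!: antimonoI)
    have "min (mf_lambda r n) (mf_mu r n p) \<le> 1 + F p / B
        \<and> 1 + F p / B \<le> max (mf_lambda r n) (mf_mu r n q)"
    proof (cases "p \<le> q")
      case True
      have "real p * B \<le> real q * F p"
        using prefix_average_antimono[OF anti True] B by (simp add: F_def)
      then have "real p / real q \<le> F p / B"
        using q B by (simp add: field_simps)
      moreover have "(real q - real p) * P q * B \<le> B - F p"
        using meta_fib_tail_ge[where r = r, OF pos True q(1)] B by (simp add: F_def P_def B_def n)
      then have "F p / B \<le> 1 + (real p - real q) * P q"
        unfolding pos_divide_le_eq[OF B(1)] by (simp add: algebra_simps)
      ultimately show ?thesis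
        by (simp add: lam mu)
    next
      case False
      then have qp: "q \<le> p" by simp
      have "real q * F p \<le> real p * B"
        using prefix_average_antimono[OF anti qp] B by (simp add: F_def)
      then have "F p / B \<le> real p / real q"
        using q B by (simp add: field_simps)
      moreover have "(real p - real q) * P p * B \<le> F p - B"
        using meta_fib_tail_ge[where r = r, OF pos qp p(1)] B by (simp add: F_def P_def B_def n)
      then have "1 + (real p - real q) * P p \<le> F p / B"
        unfolding pos_le_divide_eq[OF B(1)] by (simp add: algebra_simps)
      ultimately show ?thesis
        by (simp add: lam mu)
    qed
    then show ?thesis
      unfolding ratio[symmetric] unfolding B_def p_def q_def .
  qed
qed

end
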